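(* Let $f:\mathbb{R}^n\to\mathbb{R}$ satisfy the standing assumptions and let $T_{\mathrm{s}}\in(0,1)$. Then the map $\psi:\mathbb{R}^{2n}\to\mathbb{R}^{2n}$, $(q_k,p_k)\mapsto(q_{k+1},p_{k+1})$, given by $$p_{k+1}=p_k+T_{\mathrm{s}}\Big(-\frac1L\nabla f(q_k)+f_{\mathrm{NP}}(q_k,p_k)\Big),\qquad q_{k+1}=q_k+T_{\mathrm{s}}\,p_{k+1},$$ is a homeomorphism (a continuous bijection with continuous inverse).
   Context: Standing assumptions: $f:\mathbb{R}^n\to\mathbb{R}$ is differentiable, its gradient $\nabla f$ is Lipschitz continuous with constant $L>0$, and $f$ is strongly convex with condition number $\kappa\ge1$, i.e. $f(x)\ge f(\bar x)+\nabla f(\bar x)^{\mathsf T}(x-\bar x)+\frac{L}{2\kappa}|x-\bar x|^2$ for all $x,\bar x\in\mathbb{R}^n$; $f$ attains its minimum at $0$ and $f(0)=0$. Constants: $d=\frac{1}{\sqrt\kappa+1}$, $\beta=\frac{\sqrt\kappa-1}{\sqrt\kappa+1}$ (so $2d+\beta=1$). Non-potential forces: $f_{\mathrm{NP}}(q,p)=-2dp-\frac1L(\nabla f(q+\beta p)-\nabla f(q))$. *)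

theory Defs
  imports "HOL-Analysis.Analysis"
begin

definition grad :: "('a::real_inner \<Rightarrow> real) \<Rightarrow> 'a \<Rightarrow> 'a" where
  "grad f x = (THE D. GDERIV f x :> D)"

lemma GDERIV_grad:
  fixes f :: "'a::euclidean_space \<Rightarrow> real"
  assumes "f differentiable (at x)"
  shows "GDERIV f x :> grad f x"
proof -
  obtain f' where f': "(f has_derivative f') (at x)"
    using assms unfolding differentiable_def by blast
  have "f' = (\<lambda>h. h \<bullet> adjoint f' 1)"
    using adjoint_works[OF has_derivative_linear[OF f'], of _ 1] by (auto simp: inner_commute)
  then have "(f has_derivative (\<lambda>h. h \<bullet> adjoint f' 1)) (at x)"
    using f' by simp
  then have D: "GDERIV f x :> adjoint f' 1"
    by (simp add: gderiv_def)
  have "D' = adjoint f' 1" if "GDERIV f x :> D'" for D'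
  proof -
    have "(\<lambda>h. h \<bullet> D') = (\<lambda>h. h \<bullet> adjoint f' 1)"
      using that D unfolding gderiv_def by (rule has_derivative_unique)
    then show ?thesis
      by (metis vector_eq_ldot)
  qed
  with D show ?thesis
    unfolding grad_def by (metis theI)
qed

text \<open>Strong convexity is normalised by the gradient's Lipschitz constant \<open>L\<close>:
  the modulus of convexity is \<open>L / \<kappa>\<close>.\<close>

definition strongly_convex_cond :: "real \<Rightarrow> real \<Rightarrow> ('a::real_inner \<Rightarrow> real) \<Rightarrow> bool" where
  "strongly_convex_cond L \<kappa> f \<longleftrightarrow>
    (\<forall>x y. f x \<ge> f y + grad f y \<bullet> (x - y) + L / (2 * \<kappa>) * (norm (x - y))\<^sup>2)"

definition damping :: "real \<Rightarrow> real" where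
  "damping \<kappa> = 1 / (sqrt \<kappa> + 1)"

definition beta :: "real \<Rightarrow> real" where
  "beta \<kappa> = (sqrt \<kappa> - 1) / (sqrt \<kappa> + 1)"

definition f_NP :: "real \<Rightarrow> real \<Rightarrow> ('a::real_inner \<Rightarrow> real) \<Rightarrow> 'a \<Rightarrow> 'a \<Rightarrow> 'a" where
  "f_NP L \<kappa> f q p =
    - (2 * damping \<kappa>) *\<^sub>R p - (1 / L) *\<^sub>R (grad f (q + beta \<kappa> *\<^sub>R p) - grad f q)"

definition \<psi> :: "real \<Rightarrow> real \<Rightarrow> real \<Rightarrow> ('a::real_inner \<Rightarrow> real) \<Rightarrow> 'a \<times> 'a \<Rightarrow> 'a \<times> 'a" where
  "\<psi> T L \<kappa> f = (\<lambda>(q, p).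
    let p' = p + T *\<^sub>R (- (1 / L) *\<^sub>R grad f q + f_NP L \<kappa> f q p);
        q' = q + T *\<^sub>R p'
    in (q', p'))"

end

theory Submission
  imports Defs
begin

text \<open>
  Collecting the two gradient terms at \<open>q\<close>, which cancel, turns one step of the scheme into
  \<open>p' = (1 - 2 d T) p - (T / L) \<nabla>f (q + \<beta> p)\<close> followed by \<open>q' = q + T p'\<close>.
  The second step is a linear shear, so everything rests on solving the first equation for \<open>p\<close>
  with \<open>q\<close> fixed. There the nonlinear term is Lipschitz in \<open>p\<close> with constant \<open>T \<beta>\<close>, since
  \<open>(1 / L) \<nabla>f\<close> is nonexpansive, and the identity \<open>2 d + \<beta> = 1\<close> gives
  \<open>(1 - 2 d T) - T \<beta> = 1 - T > 0\<close>. Hence the linear term dominates: the equation is a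
  contraction fixed-point problem (\<open>dominated_perturbation_surj\<close>), and the gap \<open>1 - T\<close> bounds how
  fast its solution varies with \<open>q\<close> and \<open>p'\<close> (\<open>dominated_perturbation_expands\<close>). Together these
  give \<open>homeomorphism_dominated_perturbation\<close>, which is composed with the shear.
\<close>

text \<open>The reverse triangle inequality: the linear part expands distances in \<open>p\<close> by \<open>a\<close>, of which
  the perturbation \<open>h\<close> can undo at most \<open>M * b\<close>. This single estimate yields both injectivity
  and Lipschitz continuity of the inverse.\<close>

lemma dominated_perturbation_expands:
  fixes h :: "'a::real_normed_vector \<Rightarrow> 'a"
  assumes "M-lipschitz_on UNIV h" and "a \<ge> 0" and "b \<ge> 0"
  shows "(a - M * b) * norm (p1 - p2) \<le>
    norm ((a *\<^sub>R p1 - h (q1 + b *\<^sub>R p1)) - (a *\<^sub>R p2 - h (q2 + b *\<^sub>R p2))) + M * norm (q1 - q2)"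
    (is "_ \<le> norm ?y + _")
proof -
  let ?u1 = "q1 + b *\<^sub>R p1" and ?u2 = "q2 + b *\<^sub>R p2"
  have "M \<ge> 0"
    using assms(1) by (rule lipschitz_on_nonneg)
  have "?u1 - ?u2 = (q1 - q2) + b *\<^sub>R (p1 - p2)"
    by (simp add: algebra_simps)
  then have u: "norm (?u1 - ?u2) \<le> norm (q1 - q2) + b * norm (p1 - p2)"
    using norm_triangle_ineq[of "q1 - q2" "b *\<^sub>R (p1 - p2)"] assms(3)
    by (simp only: norm_scaleR abs_of_nonneg)
  have "norm (h ?u1 - h ?u2) \<le> M * norm (?u1 - ?u2)"
    using lipschitz_onD[OF assms(1), of ?u1 ?u2] by (simp add: dist_norm)
  also have "\<dots> \<le> M * (norm (q1 - q2) + b * norm (p1 - p2))"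
    using u \<open>M \<ge> 0\<close> by (rule mult_left_mono)
  finally have h: "norm (h ?u1 - h ?u2) \<le> M * (norm (q1 - q2) + b * norm (p1 - p2))" .
  have "a *\<^sub>R (p1 - p2) = ?y + (h ?u1 - h ?u2)"
    by (simp add: algebra_simps)
  then have "a * norm (p1 - p2) \<le> norm ?y + norm (h ?u1 - h ?u2)"
    using norm_triangle_ineq[of ?y "h ?u1 - h ?u2"] assms(2)
    by (metis abs_of_nonneg norm_scaleR)
  then show ?thesis
    using h by (simp add: algebra_simps)
qed

text \<open>Solving for the linear term, \<open>p = (1 / a) (y + h (q + b p))\<close>, exhibits a solution as a fixed
  point of a contraction with factor \<open>M * b / a < 1\<close>; Banach's theorem applies.\<close>

lemma dominated_perturbation_surj:
  fixes h :: "'a::banach \<Rightarrow> 'a"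
  assumes h: "M-lipschitz_on UNIV h" and b: "b \<ge> 0" and gap: "M * b < a"
  shows "\<exists>p. a *\<^sub>R p - h (q + b *\<^sub>R p) = y"
proof -
  have "M \<ge> 0"
    using h by (rule lipschitz_on_nonneg)
  then have "a > 0"
    using b gap by (smt (verit) mult_nonneg_nonneg)
  define F where "F p = (1 / a) *\<^sub>R (y + h (q + b *\<^sub>R p))" for p
  have contr: "dist (F p1) (F p2) \<le> (M * b / a) * dist p1 p2" for p1 p2
  proof -
    let ?u1 = "q + b *\<^sub>R p1" and ?u2 = "q + b *\<^sub>R p2"
    have "dist (h ?u1) (h ?u2) \<le> M * (b * dist p1 p2)"
      using lipschitz_onD[OF h, of ?u1 ?u2] b
      by (simp add: dist_norm flip: scaleR_diff_right)
    moreover have "dist (F p1) (F p2) = dist (h ?u1) (h ?u2) / a"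
      using \<open>a > 0\<close> by (simp add: F_def dist_norm flip: scaleR_diff_right)
    ultimately show ?thesis
      using \<open>a > 0\<close> by (simp add: divide_simps mult_ac)
  qed
  have "\<exists>!p. F p = p"
    by (rule banach_fix_type[of "M * b / a"]) (use contr \<open>M \<ge> 0\<close> \<open>a > 0\<close> b gap in simp_all)
  then obtain p where "F p = p"
    by blast
  have "a *\<^sub>R F p = y + h (q + b *\<^sub>R p)"
    using \<open>a > 0\<close> by (simp add: F_def)
  then have "a *\<^sub>R p = y + h (q + b *\<^sub>R p)"
    by (simp only: \<open>F p = p\<close>)
  then have "a *\<^sub>R p - h (q + b *\<^sub>R p) = y"
    by simp
  then show ?thesis ..
qed

text \<open>The position \<open>q\<close> is carried along as a parameter, so the inverse must be continuous jointly
  in \<open>q\<close> and \<open>y\<close>; the expansion estimate makes it jointly Lipschitz.\<close>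

lemma homeomorphism_dominated_perturbation:
  fixes h :: "'a::banach \<Rightarrow> 'a"
  assumes h: "M-lipschitz_on UNIV h" and b: "b \<ge> 0" and gap: "M * b < a"
  shows "\<exists>\<phi>. homeomorphism UNIV UNIV (\<lambda>(q, p). (q, a *\<^sub>R p - h (q + b *\<^sub>R p))) \<phi>"
proof -
  have M: "M \<ge> 0"
    using h by (rule lipschitz_on_nonneg)
  then have a: "a \<ge> 0"
    using b gap by (smt (verit) mult_nonneg_nonneg)
  let ?G = "\<lambda>q p. a *\<^sub>R p - h (q + b *\<^sub>R p)"
  note expands = dominated_perturbation_expands[OF h a b]
  obtain P where P: "?G q (P q y) = y" for q y
    using dominated_perturbation_surj[OF h b gap] by metis
  have P_left: "P q (?G q p) = p" for q p
    using expands[of "P q (?G q p)" p q q] P[of q "?G q p"] gap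
    by (simp add: mult_le_0_iff)
  define C where "C = (1 + M) / (a - M * b)"
  have "C-lipschitz_on UNIV (\<lambda>x. P (fst x) (snd x))"
  proof (rule lipschitz_onI)
    fix x1 x2 :: "'a \<times> 'a"
    have "(a - M * b) * dist (P (fst x1) (snd x1)) (P (fst x2) (snd x2))
        \<le> dist (snd x1) (snd x2) + M * dist (fst x1) (fst x2)"
      using expands[of "P (fst x1) (snd x1)" "P (fst x2) (snd x2)" "fst x1" "fst x2"]
      by (simp only: P dist_norm)
    also have "\<dots> \<le> dist x1 x2 + M * dist x1 x2"
      using M by (intro add_mono mult_left_mono dist_fst_le dist_snd_le)
    finally show "dist (P (fst x1) (snd x1)) (P (fst x2) (snd x2)) \<le> C * dist x1 x2"
      using gap by (simp add: C_def field_simps)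
  next
    show "C \<ge> 0"
      using M gap by (simp add: C_def)
  qed
  then have contP: "continuous_on UNIV (\<lambda>x. P (fst x) (snd x))"
    by (rule lipschitz_on_continuous_on)
  have "continuous_on UNIV h"
    using h by (rule lipschitz_on_continuous_on)
  then have "continuous_on UNIV (\<lambda>x. h (fst x + b *\<^sub>R snd x))"
    by (rule continuous_on_compose2) (intro continuous_intros subset_UNIV)+
  then have contG: "continuous_on UNIV (\<lambda>x. ?G (fst x) (snd x))"
    by (intro continuous_on_diff continuous_on_scaleR continuous_on_const continuous_on_snd
        continuous_on_id)
  have "homeomorphism UNIV UNIV (\<lambda>(q, p). (q, ?G q p)) (\<lambda>(q, y). (q, P q y))"
  proof (rule homeomorphismI)
    show "continuous_on UNIV (\<lambda>(q, p). (q, ?G q p))"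
      unfolding case_prod_beta by (intro continuous_on_Pair continuous_on_fst continuous_on_id contG)
    show "continuous_on UNIV (\<lambda>(q, y). (q, P q y))"
      unfolding case_prod_beta by (intro continuous_on_Pair continuous_on_fst continuous_on_id contP)
  qed (auto simp: P P_left)
  then show ?thesis
    by blast
qed

lemma homeomorphism_shear:
  fixes T :: real
  shows "homeomorphism UNIV UNIV (\<lambda>(q::'a::real_normed_vector, p). (q + T *\<^sub>R p, p))
    (\<lambda>(q, p). (q - T *\<^sub>R p, p))"
  unfolding case_prod_beta
proof (rule homeomorphismI)
  show "continuous_on UNIV (\<lambda>x :: 'a \<times> 'a. (fst x + T *\<^sub>R snd x, snd x))"
    by (intro continuous_intros)
  show "continuous_on UNIV (\<lambda>x :: 'a \<times> 'a. (fst x - T *\<^sub>R snd x, snd x))"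
    by (intro continuous_intros)
qed auto

lemma two_damping_plus_beta:
  assumes "\<kappa> \<ge> 0"
  shows "2 * damping \<kappa> + beta \<kappa> = 1"
proof -
  have "sqrt \<kappa> + 1 > 0"
    using assms by (simp add: add_nonneg_pos)
  then show ?thesis
    by (simp add: damping_def beta_def flip: add_divide_distrib)
qed

lemma beta_nonneg: "\<kappa> \<ge> 1 \<Longrightarrow> beta \<kappa> \<ge> 0"
  by (simp add: beta_def)

lemma \<psi>_eq_shear_comp:
  "\<psi> T L \<kappa> f = (\<lambda>(q, p). (q + T *\<^sub>R p, p)) \<circ>
    (\<lambda>(q, p). (q, (1 - 2 * damping \<kappa> * T) *\<^sub>R p - (T / L) *\<^sub>R grad f (q + beta \<kappa> *\<^sub>R p)))"
  by (simp add: \<psi>_def f_NP_def Let_def fun_eq_iff algebra_simps)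

theorem proposition4p3:
  fixes f :: "real ^ 'n \<Rightarrow> real" and L \<kappa> T :: real
  assumes "\<And>x. f differentiable (at x)"
    and "L > 0"
    and "L-lipschitz_on UNIV (grad f)"
    and "\<kappa> \<ge> 1"
    and "strongly_convex_cond L \<kappa> f"
    and "\<And>x. f 0 \<le> f x"
    and "f 0 = 0"
    and "T \<in> {0<..<1}"
  shows "\<exists>\<phi>. homeomorphism UNIV UNIV (\<psi> T L \<kappa> f) \<phi>"
proof -
  have T: "0 < T" "T < 1"
    using assms(8) by auto
  have "T-lipschitz_on UNIV (\<lambda>x. (T / L) *\<^sub>R grad f x)"
    using lipschitz_on_cmult[OF assms(3), of "T / L"] T \<open>L > 0\<close> by simp
  moreover have "T * beta \<kappa> < 1 - 2 * damping \<kappa> * T"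
  proof -
    have "T * (2 * damping \<kappa> + beta \<kappa>) < 1"
      using two_damping_plus_beta[of \<kappa>] T \<open>\<kappa> \<ge> 1\<close> by simp
    then show ?thesis
      by (simp add: algebra_simps)
  qed
  ultimately obtain \<phi> where "homeomorphism UNIV UNIV
      (\<lambda>(q, p). (q, (1 - 2 * damping \<kappa> * T) *\<^sub>R p - (T / L) *\<^sub>R grad f (q + beta \<kappa> *\<^sub>R p))) \<phi>"
    using homeomorphism_dominated_perturbation beta_nonneg[OF \<open>\<kappa> \<ge> 1\<close>] by blast
  from homeomorphism_compose[OF this homeomorphism_shear] show ?thesis
    unfolding \<psi>_eq_shear_comp by blast
qed

end
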